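(* Let $(L,\circ_1,\circ_2,\delta_1,\delta_2)$ be a compatible pre-LieDer pair. Define for all $x,y\in L$ $$[x,y]_{c,1}=x\circ_1y-y\circ_1x,\qquad [x,y]_{c,2}=x\circ_2y-y\circ_2x.$$ Then $(L,[\cdot,\cdot]_{c,1},[\cdot,\cdot]_{c,2},\delta_1,\delta_2)$ is a compatible LieDer pair.
   Context: All vector spaces are over a field $\mathbb{K}$ of characteristic $0$. A pre-Lie algebra $(L,\circ)$ is a vector space with a bilinear operation such that $(x\circ y)\circ z-x\circ(y\circ z)=(y\circ x)\circ z-y\circ(x\circ z)$. A pre-LieDer pair $(L,\circ,\delta)$ is a pre-Lie algebra with a linear map $\delta:L\to L$ such that $\delta(x\circ y)=\delta x\circ y+x\circ\delta y$. A compatible pre-LieDer pair $(L,\circ_1,\circ_2,\delta_1,\delta_2)$ consists of two pre-LieDer pairs $(L,\circ_1,\delta_1)$, $(L,\circ_2,\delta_2)$ such that for all $x,y,z\in L$: $x\circ_1(y\circ_2z)+x\circ_2(y\circ_1z)-(x\circ_2y)\circ_1z-(x\circ_1y)\circ_2z=y\circ_1(x\circ_2z)+y\circ_2(x\circ_1z)-(y\circ_2x)\circ_1z-(y\circ_1x)\circ_2z$ and $\delta_1(x\circ_2y)+\delta_2(x\circ_1y)=\delta_1x\circ_2y+x\circ_2\delta_1y+\delta_2x\circ_1y+x\circ_1\delta_2y$. A LieDer pair $(L,[\cdot,\cdot],\delta)$ is a Lie algebra with a linear map $\delta$ such that $\delta[x,y]=[\delta x,y]+[x,\delta y]$. A compatible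 LieDer pair $(L,[\cdot,\cdot]_1,[\cdot,\cdot]_2,\delta_1,\delta_2)$ consists of two LieDer pairs $(L,[\cdot,\cdot]_1,\delta_1)$, $(L,[\cdot,\cdot]_2,\delta_2)$ on the same vector space such that for all $x,y,z\in L$ (with $\circlearrowleft_{x,y,z}$ the sum over cyclic permutations of $x,y,z$): (1) $\circlearrowleft_{x,y,z}[x,[y,z]_1]_2+\circlearrowleft_{x,y,z}[x,[y,z]_2]_1=0$; (2) $\delta_1[x,y]_2+\delta_2[x,y]_1=[\delta_1x,y]_2+[x,\delta_1y]_2+[\delta_2x,y]_1+[x,\delta_2y]_1$. *)

theory Defs
  imports Complex_Main
begin

text \<open>
  The underlying vector space is a whole type \<open>'v\<close>, with scalar multiplication \<open>scale\<close> by a field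
  \<open>'k\<close> of characteristic 0. No finiteness of dimension is assumed.
\<close>

locale bilinear_operation = vector_space scale
  for scale :: "'k::field_char_0 \<Rightarrow> 'v::ab_group_add \<Rightarrow> 'v" +
  fixes mult :: "'v \<Rightarrow> 'v \<Rightarrow> 'v"
  assumes linear_right: "Vector_Spaces.linear scale scale (\<lambda>y. mult x y)"
    and linear_left: "Vector_Spaces.linear scale scale (\<lambda>x. mult x y)"

locale linear_derivation = bilinear_operation scale mult
  for scale :: "'k::field_char_0 \<Rightarrow> 'v::ab_group_add \<Rightarrow> 'v"
    and mult :: "'v \<Rightarrow> 'v \<Rightarrow> 'v" +
  fixes \<delta> :: "'v \<Rightarrow> 'v"
  assumes linear_\<delta>: "Vector_Spaces.linear scale scale \<delta>"
    and Leibniz: "\<delta> (mult x y) = mult (\<delta> x) y + mult x (\<delta> y)"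

locale pre_Lie_algebra = bilinear_operation scale mult
  for scale :: "'k::field_char_0 \<Rightarrow> 'v::ab_group_add \<Rightarrow> 'v"
    and mult :: "'v \<Rightarrow> 'v \<Rightarrow> 'v" +
  assumes left_symmetric:
    "mult (mult x y) z - mult x (mult y z) = mult (mult y x) z - mult y (mult x z)"

locale Lie_algebra = bilinear_operation scale bracket
  for scale :: "'k::field_char_0 \<Rightarrow> 'v::ab_group_add \<Rightarrow> 'v"
    and bracket :: "'v \<Rightarrow> 'v \<Rightarrow> 'v" +
  assumes alternating: "bracket x x = 0"
    and Jacobi: "bracket x (bracket y z) + bracket y (bracket z x) + bracket z (bracket x y) = 0"

locale pre_LieDer_pair = pre_Lie_algebra scale mult + linear_derivation scale mult \<delta>
  for scale :: "'k::field_char_0 \<Rightarrow> 'v::ab_group_add \<Rightarrow> 'v"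
    and mult :: "'v \<Rightarrow> 'v \<Rightarrow> 'v"
    and \<delta> :: "'v \<Rightarrow> 'v"

locale LieDer_pair = Lie_algebra scale bracket + linear_derivation scale bracket \<delta>
  for scale :: "'k::field_char_0 \<Rightarrow> 'v::ab_group_add \<Rightarrow> 'v"
    and bracket :: "'v \<Rightarrow> 'v \<Rightarrow> 'v"
    and \<delta> :: "'v \<Rightarrow> 'v"

locale compatible_pre_LieDer_pair =
  fst: pre_LieDer_pair scale m1 \<delta>1 + snd: pre_LieDer_pair scale m2 \<delta>2
  for scale :: "'k::field_char_0 \<Rightarrow> 'v::ab_group_add \<Rightarrow> 'v"
    and m1 :: "'v \<Rightarrow> 'v \<Rightarrow> 'v"
    and m2 :: "'v \<Rightarrow> 'v \<Rightarrow> 'v"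
    and \<delta>1 :: "'v \<Rightarrow> 'v"
    and \<delta>2 :: "'v \<Rightarrow> 'v" +
  assumes compatible_mult:
    "m1 x (m2 y z) + m2 x (m1 y z) - m1 (m2 x y) z - m2 (m1 x y) z
      = m1 y (m2 x z) + m2 y (m1 x z) - m1 (m2 y x) z - m2 (m1 y x) z"
    and compatible_derivation:
    "\<delta>1 (m2 x y) + \<delta>2 (m1 x y)
      = m2 (\<delta>1 x) y + m2 x (\<delta>1 y) + m1 (\<delta>2 x) y + m1 x (\<delta>2 y)"

locale compatible_LieDer_pair =
  fst: LieDer_pair scale b1 \<delta>1 + snd: LieDer_pair scale b2 \<delta>2
  for scale :: "'k::field_char_0 \<Rightarrow> 'v::ab_group_add \<Rightarrow> 'v"
    and b1 :: "'v \<Rightarrow> 'v \<Rightarrow> 'v"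
    and b2 :: "'v \<Rightarrow> 'v \<Rightarrow> 'v"
    and \<delta>1 :: "'v \<Rightarrow> 'v"
    and \<delta>2 :: "'v \<Rightarrow> 'v" +
  assumes compatible_bracket:
    "(b2 x (b1 y z) + b2 y (b1 z x) + b2 z (b1 x y))
      + (b1 x (b2 y z) + b1 y (b2 z x) + b1 z (b2 x y)) = 0"
    and compatible_derivation:
    "\<delta>1 (b2 x y) + \<delta>2 (b1 x y)
      = b2 (\<delta>1 x) y + b2 x (\<delta>1 y) + b1 (\<delta>2 x) y + b1 x (\<delta>2 y)"

end

theory Submission
  imports Defs
begin

text \<open>
  Expanding the commutators, each cyclic sum becomes an alternating sum of associators over the six
  permutations of \<open>x, y, z\<close>. Left symmetry, applied to the three cyclic pairs, cancels it; the
  compatibility law cancels the mixed sum in the same way.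
\<close>

context bilinear_operation
begin

lemma mult_diff_right: "mult x (y - z) = mult x y - mult x z"
  using linear_right[of x] by (rule Vector_Spaces.linear.axioms(3)[THEN module_hom.diff])

lemma mult_diff_left: "mult (x - y) z = mult x z - mult y z"
  using linear_left[of z] by (rule Vector_Spaces.linear.axioms(3)[THEN module_hom.diff])

text \<open>In each argument the commutator is a difference of a left and a right multiplication,
  and both are linear.\<close>

lemma bilinear_operation_commutator:
  "bilinear_operation scale (\<lambda>x y. mult x y - mult y x)"
proof -
  interpret vector_space_pair scale scale ..
  show ?thesis
    by (intro bilinear_operation.intro bilinear_operation_axioms.intro vector_space_axioms
        linear_compose_sub linear_left linear_right)
qed

end

lemma (in pre_Lie_algebra) Lie_algebra_commutator:
  "Lie_algebra scale (\<lambda>x y. mult x y - mult y x)"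
proof -
  interpret C: bilinear_operation scale "\<lambda>x y. mult x y - mult y x"
    by (rule bilinear_operation_commutator)
  \<comment> \<open>Left symmetry solved for one term. It would loop as a general rewrite rule, so
    it is instantiated at the three cyclic triples only; no left side then recurs in a right
    side.\<close>
  have left_symmetric':
    "mult (mult x y) z = mult (mult y x) z - mult y (mult x z) + mult x (mult y z)" for x y z
    using left_symmetric[of x y z] by (simp add: diff_eq_eq)
  show ?thesis
  proof
    fix x y z
    show "mult x (mult y z - mult z y) - mult (mult y z - mult z y) x
        + (mult y (mult z x - mult x z) - mult (mult z x - mult x z) y)
        + (mult z (mult x y - mult y x) - mult (mult x y - mult y x) z) = 0"
      by (simp add: mult_diff_left mult_diff_right left_symmetric'[of x y z]
          left_symmetric'[of y z x] left_symmetric'[of z x y])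
  qed simp
qed

text \<open>Subtract the Leibniz rule at \<open>(y, x)\<close> from the one at
  \<open>(x, y)\<close>.\<close>

lemma (in linear_derivation) linear_derivation_commutator:
  "linear_derivation scale (\<lambda>x y. mult x y - mult y x) \<delta>"
proof -
  interpret C: bilinear_operation scale "\<lambda>x y. mult x y - mult y x"
    by (rule bilinear_operation_commutator)
  interpret \<delta>: Vector_Spaces.linear scale scale \<delta>
    by (rule linear_\<delta>)
  show ?thesis
    by unfold_locales (simp_all add: linear_\<delta> \<delta>.diff Leibniz)
qed

lemma (in pre_LieDer_pair) LieDer_pair_commutator:
  "LieDer_pair scale (\<lambda>x y. mult x y - mult y x) \<delta>"
  by (intro LieDer_pair.intro Lie_algebra_commutator linear_derivation_commutator)

theorem proposition4p10:
  fixes scale :: "'k::field_char_0 \<Rightarrow> 'v::ab_group_add \<Rightarrow> 'v"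
    and m1 m2 :: "'v \<Rightarrow> 'v \<Rightarrow> 'v"
    and \<delta>1 \<delta>2 :: "'v \<Rightarrow> 'v"
  assumes "compatible_pre_LieDer_pair scale m1 m2 \<delta>1 \<delta>2"
  shows "compatible_LieDer_pair scale
           (\<lambda>x y. m1 x y - m1 y x) (\<lambda>x y. m2 x y - m2 y x) \<delta>1 \<delta>2"
proof -
  interpret compatible_pre_LieDer_pair scale m1 m2 \<delta>1 \<delta>2
    by (rule assms)
  interpret \<delta>1: Vector_Spaces.linear scale scale \<delta>1
    by (rule fst.linear_\<delta>)
  interpret \<delta>2: Vector_Spaces.linear scale scale \<delta>2
    by (rule snd.linear_\<delta>)
  have compatible_mult':
    "m1 (m2 x y) z = m1 x (m2 y z) + m2 x (m1 y z) - m2 (m1 x y) z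
      - (m1 y (m2 x z) + m2 y (m1 x z) - m1 (m2 y x) z - m2 (m1 y x) z)" for x y z
    \<comment> \<open>Once the subtracted group is replaced by the other side of the compatibility
      law, all but \<open>m1 (m2 x y) z\<close> cancels.\<close>
    unfolding compatible_mult[of x y z, symmetric] by simp
  \<comment> \<open>Compatibility controls only the sum of the two mixed terms, so they are
    regrouped into two instances of its left side, at \<open>(x, y)\<close> and
    \<open>(y, x)\<close>.\<close>
  have derivation_commutator:
    "\<delta>1 (m2 x y - m2 y x) + \<delta>2 (m1 x y - m1 y x)
      = (\<delta>1 (m2 x y) + \<delta>2 (m1 x y)) - (\<delta>1 (m2 y x) + \<delta>2 (m1 y x))" for x y
    by (simp add: \<delta>1.diff \<delta>2.diff)
  show ?thesis
  \<comment> \<open>Each bracket separately forms a LieDer pair; only the two mixed identities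
    remain.\<close>
  proof (intro compatible_LieDer_pair.intro compatible_LieDer_pair_axioms.intro
      fst.LieDer_pair_commutator snd.LieDer_pair_commutator, goal_cases)
    case (1 x y z)
    show ?case
      by (simp add: fst.mult_diff_left fst.mult_diff_right snd.mult_diff_left snd.mult_diff_right
          compatible_mult'[of x y z] compatible_mult'[of y z x] compatible_mult'[of z x y])
  next
    case (2 x y)
    show ?case
      by (simp add: derivation_commutator compatible_derivation)
  qed
qed

end
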